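(* Let $X$ be a real normed space and let $\mathcal F_{\mathrm{BP}}:=\{C(f,\alpha):f\in S_{X^*},\ 0<\alpha<1\}$, where $C(f,\alpha):=\{x\in X:f(x)\ge\alpha\|x\|\}$. The family $\mathcal F_{\mathrm{BP}}$ is directionally fine if and only if every point of $S_X$ is a denting point of $B_X$. Consequently, whenever this condition holds, $\mathcal F_{\mathrm{BP}}$ is a convex directionally fine family.
   Context: $S_X$, $B_X$ are the unit sphere and closed unit ball of $X$, $S_{X^*}$ the unit sphere of the dual, $B(x,r)=x+rB_X$, $\operatorname{cone}(A)=\{ta:t\ge0,\ a\in A\}$. A family $\mathcal F$ of closed cones in $X$ is directionally fine if for every $u\in S_X$ and $\varepsilon\in(0,1)$ there exists $C\in\mathcal F$ with $u\in\operatorname{int}C\subset C\subset\operatorname{cone}B(u,\varepsilon)$; it is convex directionally fine if $C$ can always be chosen convex. A point $u\in B_X$ is a denting point of $B_X$ if for every $\varepsilon>0$ there exist $f\in S_{X^*}$ and $\gamma>0$ such that the slice $S(B_X,f,\gamma):=\{x\in B_X:f(x)>1-\gamma\}$ contains $u$ and has diameter $<\varepsilon$. *)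

theory Defs
  imports "HOL-Analysis.Analysis"
begin

(* The library's cone is a predicate on sets; this is the set generated by A. *)
definition cone_of :: "'a::real_vector set \<Rightarrow> 'a set" where
  "cone_of A = {t *\<^sub>R a | t a. 0 \<le> t \<and> a \<in> A}"

definition closed_cone_family :: "'a::real_normed_vector set set \<Rightarrow> bool" where
  "closed_cone_family \<F> \<longleftrightarrow> (\<forall>C\<in>\<F>. closed C \<and> cone C)"

definition directionally_fine :: "'a::real_normed_vector set set \<Rightarrow> bool" where
  "directionally_fine \<F> \<longleftrightarrow> closed_cone_family \<F> \<and>
     (\<forall>u\<in>sphere 0 1. \<forall>\<epsilon>\<in>{0<..<1}. \<exists>C\<in>\<F>.
        u \<in> interior C \<and> C \<subseteq> cone_of (cball u \<epsilon>))"

definition convex_directionally_fine :: "'a::real_normed_vector set set \<Rightarrow> bool" where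
  "convex_directionally_fine \<F> \<longleftrightarrow> closed_cone_family \<F> \<and>
     (\<forall>u\<in>sphere 0 1. \<forall>\<epsilon>\<in>{0<..<1}. \<exists>C\<in>\<F>. convex C \<and>
        u \<in> interior C \<and> C \<subseteq> cone_of (cball u \<epsilon>))"

definition ball_slice :: "('a::real_normed_vector \<Rightarrow>\<^sub>L real) \<Rightarrow> real \<Rightarrow> 'a set" where
  "ball_slice f \<gamma> = {x \<in> cball 0 1. blinfun_apply f x > 1 - \<gamma>}"

definition denting_point :: "'a::real_normed_vector \<Rightarrow> bool" where
  "denting_point u \<longleftrightarrow> u \<in> cball 0 1 \<and>
     (\<forall>\<epsilon>>0. \<exists>f\<in>sphere 0 1. \<exists>\<gamma>>0. u \<in> ball_slice f \<gamma> \<and> diameter (ball_slice f \<gamma>) < \<epsilon>)"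

definition BP_cone :: "('a::real_normed_vector \<Rightarrow>\<^sub>L real) \<Rightarrow> real \<Rightarrow> 'a set" where
  "BP_cone f \<alpha> = {x. blinfun_apply f x \<ge> \<alpha> * norm x}"

definition BP_family :: "'a::real_normed_vector set set" where
  "BP_family = {BP_cone f \<alpha> | f \<alpha>. f \<in> sphere 0 1 \<and> 0 < \<alpha> \<and> \<alpha> < 1}"

end

theory Submission
  imports Defs
begin

text \<open>
  For a unit vector \<open>x\<close>, membership in \<open>C(f,\<alpha>)\<close> means \<open>f x \<ge> \<alpha>\<close>, so the cones of the
  family correspond to slices of the ball. If \<open>u\<close> lies in a slice of diameter less than \<open>\<epsilon> < 1\<close>,
  this slice misses \<open>0\<close>, and raising its level slightly gives a cone around \<open>u\<close> whose unit vectors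
  all stay in the slice. Conversely, if \<open>C(f,\<alpha>)\<close> lies in the cone over \<open>B(u,\<delta>)\<close>, its unit
  vectors are within \<open>2\<delta>\<close> of \<open>u\<close>. The level \<open>\<alpha>\<close> itself may be far from 1, but almost norming
  vectors of \<open>f\<close> are close to \<open>u\<close>, so \<open>f u\<close> is close to 1 and the slice can be cut at a level
  close to 1, which forces its elements to have norm close to 1 as well.
\<close>

lemma closed_BP_cone: "closed (BP_cone f \<alpha>)"
  unfolding BP_cone_def by (intro closed_Collect_le continuous_intros)

lemma cone_BP_cone: "cone (BP_cone f \<alpha>)"
  unfolding cone_def BP_cone_def
  by (auto simp: blinfun.scaleR_right mult.left_commute intro: mult_left_mono)

lemma convex_BP_cone:
  assumes "0 \<le> \<alpha>"
  shows "convex (BP_cone f \<alpha>)"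
proof (rule convexI)
  fix x y and s t :: real
  assume xy: "x \<in> BP_cone f \<alpha>" "y \<in> BP_cone f \<alpha>" and st: "0 \<le> s" "0 \<le> t" "s + t = 1"
  have "\<alpha> * norm (s *\<^sub>R x + t *\<^sub>R y) \<le> \<alpha> * (s * norm x + t * norm y)"
    using st norm_triangle_ineq[of "s *\<^sub>R x" "t *\<^sub>R y"] by (intro mult_left_mono assms) simp
  also have "\<dots> = s * (\<alpha> * norm x) + t * (\<alpha> * norm y)"
    by (simp add: algebra_simps)
  also have "\<dots> \<le> s * f x + t * f y"
    using xy st by (intro add_mono mult_left_mono) (auto simp: BP_cone_def)
  finally show "s *\<^sub>R x + t *\<^sub>R y \<in> BP_cone f \<alpha>"
    by (simp add: BP_cone_def blinfun.add_right blinfun.scaleR_right)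
qed

lemma closed_cone_family_BP: "closed_cone_family BP_family"
  by (auto simp: closed_cone_family_def BP_family_def closed_BP_cone cone_BP_cone)

lemma blinfun_le_norm:
  fixes f :: "'a::real_normed_vector \<Rightarrow>\<^sub>L real"
  assumes "norm f = 1"
  shows "f x \<le> norm x"
  using norm_blinfun[of f x] assms by simp

text \<open>The norm of \<open>f\<close> need not be attained. If no vector beat the factor
  \<open>c\<close>, then \<open>c\<close> would bound the operator norm, against
  \<open>c < 1\<close>; normalising and a change of sign do the rest.\<close>

lemma exists_almost_norming:
  fixes f :: "'a::real_normed_vector \<Rightarrow>\<^sub>L real"
  assumes "norm f = 1" "0 \<le> c" "c < 1"
  obtains y where "norm y = 1" "c < f y"
proof -
  have "\<exists>x. c * norm x < norm (f x)"
    using norm_blinfun_bound[of c f] assms by (force simp: not_less[symmetric])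
  then obtain x where x: "c * norm x < \<bar>f x\<bar>" by auto
  then have "x \<noteq> 0" by auto
  define y where "y = (sgn (f x) / norm x) *\<^sub>R x"
  have "f x \<noteq> 0" using x assms(2) by (metis abs_zero mult_nonneg_nonneg norm_ge_zero not_less)
  then have "norm y = 1"
    using \<open>x \<noteq> 0\<close> by (simp add: y_def abs_sgn_eq)
  moreover have "f y = \<bar>f x\<bar> / norm x"
    by (simp add: y_def blinfun.scaleR_right abs_sgn mult.commute)
  then have "c < f y" using x \<open>x \<noteq> 0\<close> by (simp add: less_divide_eq)
  ultimately show thesis by (rule that)
qed

text \<open>Stepping back from \<open>u\<close> along an almost norming \<open>v\<close> stays in
  the cone for small \<open>e\<close>. This lowers \<open>f\<close> by more than
  \<open>e * \<alpha>\<close>, but the norm by at most \<open>e\<close>, so the inequality at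
  \<open>u\<close> was strict.\<close>

lemma interior_BP_cone_imp_gt:
  assumes f: "norm f = 1" and \<alpha>: "0 \<le> \<alpha>" "\<alpha> < 1" and u: "u \<in> interior (BP_cone f \<alpha>)"
  shows "\<alpha> * norm u < f u"
proof -
  obtain v where v: "norm v = 1" "\<alpha> < f v"
    using exists_almost_norming[OF f \<alpha>] .
  obtain e where e: "e > 0" "cball u e \<subseteq> BP_cone f \<alpha>"
    using u by (auto simp: mem_interior_cball)
  have "u - e *\<^sub>R v \<in> BP_cone f \<alpha>"
    using e v by (intro subsetD[OF e(2)]) (simp add: dist_norm)
  then have "\<alpha> * norm (u - e *\<^sub>R v) \<le> f u - e * f v"
    by (simp add: BP_cone_def blinfun.diff_right blinfun.scaleR_right)
  moreover have "\<alpha> * (norm u - e) \<le> \<alpha> * norm (u - e *\<^sub>R v)"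
    using norm_triangle_ineq2[of u "e *\<^sub>R v"] e v by (intro mult_left_mono \<alpha>) simp
  moreover have "e * \<alpha> < e * f v" using e v by simp
  ultimately show ?thesis by (simp add: algebra_simps)
qed

text \<open>The points \<open>x\<close> and \<open>b\<close> lie on one ray, so their distance is
  the difference of their norms, at most \<delta> because \<open>u\<close> also has norm 1. Going
  from \<open>b\<close> to \<open>u\<close> costs another \<delta>.\<close>

lemma dist_le_of_mem_cone_of_cball:
  assumes "norm u = 1" "norm x = 1" "x \<in> cone_of (cball u \<delta>)"
  shows "dist x u \<le> 2 * \<delta>"
proof -
  obtain t b where tb: "x = t *\<^sub>R b" "0 \<le> t" "dist u b \<le> \<delta>"
    using assms(3) by (auto simp: cone_of_def)
  have "norm (x - b) = \<bar>t - 1\<bar> * norm b"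
    by (simp add: tb(1) flip: scaleR_left_diff_distrib norm_scaleR)
      (simp add: algebra_simps)
  also have "\<dots> = \<bar>t * norm b - norm b\<bar>"
    by (simp add: abs_mult flip: left_diff_distrib[of t 1 "norm b", simplified])
  also have "\<dots> = \<bar>norm u - norm b\<bar>"
    using assms tb by simp
  also have "\<dots> \<le> \<delta>"
    using norm_triangle_ineq3[of u b] tb(3) by (simp add: dist_norm)
  finally have "dist x b \<le> \<delta>" by (simp add: dist_norm)
  then show ?thesis
    using dist_triangle[of x u b] tb(3) by (simp add: dist_commute)
qed

lemma bounded_ball_slice: "bounded (ball_slice f \<gamma>)"
  by (rule bounded_subset[OF bounded_cball[of 0 1]]) (auto simp: ball_slice_def)

text \<open>Convexity is carried along so that this one construction serves both the equivalence and
  the final claim.\<close>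

lemma denting_point_imp_BP_cone:
  fixes u :: "'a::real_normed_vector"
  assumes u: "norm u = 1" "denting_point u" and \<epsilon>: "0 < \<epsilon>" "\<epsilon> < 1"
  shows "\<exists>C\<in>BP_family. convex C \<and> u \<in> interior C \<and> C \<subseteq> cone_of (cball u \<epsilon>)"
proof -
  obtain f \<gamma> where f: "norm f = 1" and \<gamma>: "u \<in> ball_slice f \<gamma>" "diameter (ball_slice f \<gamma>) < \<epsilon>"
    using u \<epsilon> by (fastforce simp: denting_point_def)
  have near: "dist u x < \<epsilon>" if "x \<in> ball_slice f \<gamma>" for x
    using diameter_bounded_bound[OF bounded_ball_slice \<gamma>(1) that] \<gamma>(2) by simp
  \<comment> \<open>The distance from \<open>0\<close> to \<open>u\<close> is 1, above \<epsilon>.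
    Hence the level \<open>1 - \<gamma>\<close> is nonnegative, which makes \<alpha> positive
    below.\<close>
  have "0 \<notin> ball_slice f \<gamma>"
    using near[of 0] u \<epsilon> by auto
  then have "\<gamma> \<le> 1" by (simp add: ball_slice_def)
  have fu: "1 - \<gamma> < f u" "f u \<le> 1"
    using \<gamma>(1) blinfun_le_norm[OF f, of u] u by (auto simp: ball_slice_def)
  \<comment> \<open>The lower bound puts the unit vectors of the cone into the open slice; the upper
    one makes \<open>u\<close> an interior point.\<close>
  obtain \<alpha> where \<alpha>: "1 - \<gamma> < \<alpha>" "\<alpha> < f u"
    using dense[OF fu(1)] by auto
  have \<alpha>01: "0 < \<alpha>" "\<alpha> < 1" using \<alpha> fu \<open>\<gamma> \<le> 1\<close> by auto
  have "u \<in> interior (BP_cone f \<alpha>)"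
  proof (rule interiorI)
    show "open {x. \<alpha> * norm x < f x}" by (intro open_Collect_less continuous_intros)
  qed (use \<alpha> u in \<open>auto simp: BP_cone_def\<close>)
  moreover have "BP_cone f \<alpha> \<subseteq> cone_of (cball u \<epsilon>)"
  proof
    fix x assume x: "x \<in> BP_cone f \<alpha>"
    show "x \<in> cone_of (cball u \<epsilon>)"
    proof (cases "x = 0")
      case True
      then have "x = 0 *\<^sub>R u" "u \<in> cball u \<epsilon>" using \<epsilon> by auto
      then show ?thesis unfolding cone_of_def by blast
    next
      case False
      have "\<alpha> \<le> f (x /\<^sub>R norm x)"
        using x False by (simp add: BP_cone_def blinfun.scaleR_right field_simps)
      then have "x /\<^sub>R norm x \<in> ball_slice f \<gamma>"
        using False \<alpha> by (simp add: ball_slice_def)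
      then have "x /\<^sub>R norm x \<in> cball u \<epsilon>"
        using near by fastforce
      moreover have "x = norm x *\<^sub>R (x /\<^sub>R norm x)" using False by simp
      ultimately show ?thesis unfolding cone_of_def using norm_ge_zero by blast
    qed
  qed
  moreover have "BP_cone f \<alpha> \<in> BP_family"
    using f \<alpha>01 by (auto simp: BP_family_def)
  ultimately show ?thesis using convex_BP_cone \<alpha>01 by (metis less_imp_le)
qed

lemma directionally_fine_BP_imp_denting_point:
  fixes u :: "'a::real_normed_vector"
  assumes fine: "directionally_fine (BP_family :: 'a set set)" and u: "norm u = 1"
  shows "denting_point u"
  unfolding denting_point_def
proof (intro conjI allI impI)
  show "u \<in> cball 0 1" using u by simp
next
  fix \<epsilon> :: real assume "\<epsilon> > 0"
  \<comment> \<open>The slice found below has diameter at most \<open>10 * \<delta>\<close>;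
    dividing by 11 makes this strictly less than \<epsilon>.\<close>
  define \<delta> where "\<delta> = min (1/4) (\<epsilon> / 11)"
  have \<delta>: "0 < \<delta>" "\<delta> \<le> 1/4" "10 * \<delta> < \<epsilon>"
    using \<open>\<epsilon> > 0\<close> by (auto simp: \<delta>_def min_def)
  have "u \<in> sphere 0 1" "\<delta> \<in> {0<..<1}" using u \<delta> by auto
  then obtain C where "C \<in> BP_family" "u \<in> interior C" "C \<subseteq> cone_of (cball u \<delta>)"
    using fine unfolding directionally_fine_def by blast
  then obtain f \<alpha> where f: "norm f = 1" and \<alpha>: "0 < \<alpha>" "\<alpha> < 1"
    and int: "u \<in> interior (BP_cone f \<alpha>)" and sub: "BP_cone f \<alpha> \<subseteq> cone_of (cball u \<delta>)"
    by (auto simp: BP_family_def)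
  have near: "dist x u \<le> 2 * \<delta>" if "norm x = 1" "\<alpha> \<le> f x" for x
    using that sub u by (intro dist_le_of_mem_cone_of_cball) (auto simp: BP_cone_def)
  \<comment> \<open>Exceeding \<alpha> puts \<open>y\<close> in the cone, hence within
    \<open>2 * \<delta>\<close> of \<open>u\<close>; exceeding \<open>1 - \<delta>\<close> then
    gives \<open>f u > 1 - 3 * \<delta>\<close>, as \<open>f\<close> is 1-Lipschitz.\<close>
  obtain y where y: "norm y = 1" "max \<alpha> (1 - \<delta>) < f y"
    using exists_almost_norming[OF f, of "max \<alpha> (1 - \<delta>)"] \<alpha> \<delta>
    by (metis diff_less_eq le_max_iff_disj less_add_same_cancel1 less_imp_le max_less_iff_conj)
  have "f y - f u \<le> dist y u"
    using blinfun_le_norm[OF f, of "y - u"] by (simp add: blinfun.diff_right dist_norm)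
  then have "1 - 3 * \<delta> < f u" using near[of y] y by simp
  \<comment> \<open>Strictness is needed for \<open>u\<close> to lie in the slice at level \<beta>
    when the maximum defining \<beta> is \<alpha>.\<close>
  moreover have "\<alpha> < f u"
    using interior_BP_cone_imp_gt[OF f _ _ int] \<alpha> u by simp
  moreover define \<beta> where "\<beta> = max \<alpha> (1 - 3 * \<delta>)"
  ultimately have \<beta>: "\<beta> < f u" "\<alpha> \<le> \<beta>" "1 - 3 * \<delta> \<le> \<beta>" "\<beta> < 1"
    using \<alpha> \<delta> by auto
  \<comment> \<open>Normalising \<open>x\<close> moves it by \<open>1 - norm x\<close>, less than
    \<open>3 * \<delta>\<close>, and the normalised vector is within \<open>2 * \<delta>\<close> of
    \<open>u\<close>.\<close>
  have slice: "dist x u \<le> 5 * \<delta>" if x: "x \<in> ball_slice f (1 - \<beta>)" for x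
  proof -
    have fx: "\<beta> < f x" "norm x \<le> 1" using x by (auto simp: ball_slice_def)
    have nx: "\<beta> < norm x" using fx blinfun_le_norm[OF f, of x] by simp
    then have pos: "0 < norm x" using \<alpha> \<beta> by linarith
    \<comment> \<open>Normalising does not lower the positive value \<open>f x\<close>, so the unit
      vector stays in the cone.\<close>
    have "f x \<le> f x / norm x"
      using pos fx \<alpha> \<beta> by (simp add: le_divide_eq mult_left_le)
    then have "dist (x /\<^sub>R norm x) u \<le> 2 * \<delta>"
      using pos fx \<beta> by (intro near) (auto simp: blinfun.scaleR_right divide_inverse mult.commute)
    moreover have "x - x /\<^sub>R norm x = (norm x - 1) *\<^sub>R (x /\<^sub>R norm x)"
      using pos by (simp add: algebra_simps)
    then have "dist x (x /\<^sub>R norm x) = \<bar>norm x - 1\<bar>"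
      using pos by (simp add: dist_norm abs_mult)
    ultimately show ?thesis
      using dist_triangle[of x u "x /\<^sub>R norm x"] nx fx \<beta> by linarith
  qed
  have "diameter (ball_slice f (1 - \<beta>)) \<le> 10 * \<delta>"
  proof (rule diameter_le)
    fix x y assume "x \<in> ball_slice f (1 - \<beta>)" "y \<in> ball_slice f (1 - \<beta>)"
    then show "norm (x - y) \<le> 10 * \<delta>"
      using slice[of x] slice[of y] dist_triangle2[of x y u] by (simp add: dist_norm)
  qed (use \<delta> in simp)
  moreover have "u \<in> ball_slice f (1 - \<beta>)"
    using u \<beta> by (simp add: ball_slice_def)
  ultimately show "\<exists>f\<in>sphere 0 1. \<exists>\<gamma>>0. u \<in> ball_slice f \<gamma> \<and> diameter (ball_slice f \<gamma>) < \<epsilon>"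
    using f \<beta> \<delta> by (intro bexI[of _ f] exI[of _ "1 - \<beta>"]) auto
qed

lemma convex_directionally_fine_imp_directionally_fine:
  "convex_directionally_fine \<F> \<Longrightarrow> directionally_fine \<F>"
  unfolding convex_directionally_fine_def directionally_fine_def by blast

theorem theorem4p1:
  shows "(directionally_fine (BP_family :: 'a::real_normed_vector set set) \<longleftrightarrow>
           (\<forall>u\<in>sphere (0::'a) 1. denting_point u)) \<and>
         ((\<forall>u\<in>sphere (0::'a) 1. denting_point u) \<longrightarrow>
           convex_directionally_fine (BP_family :: 'a set set))"
proof -
  have "convex_directionally_fine (BP_family :: 'a set set)"
    if "\<forall>u\<in>sphere (0::'a) 1. denting_point u"
    unfolding convex_directionally_fine_def
    using that by (auto intro!: denting_point_imp_BP_cone closed_cone_family_BP)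
  then show ?thesis
    using directionally_fine_BP_imp_denting_point convex_directionally_fine_imp_directionally_fine
    by auto
qed

end
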